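(* Suppose all items in the input sequence have size at most $1/d$ for a real $d\ge 2$. Then Worst Fit is absolutely $(1+d/(d-1))$-competitive for Black and White Bin Packing, i.e., it uses at most $(1+d/(d-1))\cdot\mathrm{OPT}(L)$ bins on every such input $L$.
   Context: Black and White Bin Packing: items arrive as a sequence; each item has a size in $[0,1]$ and a color that is either black or white. A packing places items into unit-capacity bins, items in a bin ordered by arrival; it is valid if each bin has total size at most $1$ and no two consecutive items in a bin have the same color. $\mathrm{OPT}(L)$ is the minimum number of bins in a valid packing of $L$ without reordering. Worst Fit is the online algorithm that packs each incoming item into a bin of lowest current level (total size of its items) among the bins into which the item can be validly added, and opens a new bin only if there is no such bin. *)

theory Defs
  imports Complex_Main
begin

datatype color = Black | White

datatype item = Item (item_size: real) (item_color: color)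

text \<open>A bin is the list of its items in order of arrival.\<close>

definition level :: "item list \<Rightarrow> real" where
  "level b = sum_list (map item_size b)"

definition valid_bin :: "item list \<Rightarrow> bool" where
  "valid_bin b \<longleftrightarrow> level b \<le> 1 \<and> successively (\<lambda>x y. item_color x \<noteq> item_color y) b"

text \<open>A packing of \<open>L\<close> is given by a function \<open>f\<close> on positions, where \<open>f i\<close> is the name of the
  bin that receives the item \<open>L ! i\<close>; only the values at \<open>i < length L\<close> matter.\<close>

definition bin :: "item list \<Rightarrow> (nat \<Rightarrow> nat) \<Rightarrow> nat \<Rightarrow> item list" where
  "bin L f b = nths L {i. f i = b}"

definition bins_used :: "item list \<Rightarrow> (nat \<Rightarrow> nat) \<Rightarrow> nat set" where
  "bins_used L f = f ` {..<length L}"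

definition valid_packing :: "item list \<Rightarrow> (nat \<Rightarrow> nat) \<Rightarrow> bool" where
  "valid_packing L f \<longleftrightarrow> (\<forall>b \<in> bins_used L f. valid_bin (bin L f b))"

definition OPT :: "item list \<Rightarrow> nat" where
  "OPT L = (LEAST n. \<exists>f. valid_packing L f \<and> card (bins_used L f) = n)"

text \<open>Open bins into which \<open>x\<close> can be validly added once the items in \<open>L\<close> have been packed
  according to \<open>f\<close>.\<close>

definition feasible_bins :: "item list \<Rightarrow> (nat \<Rightarrow> nat) \<Rightarrow> item \<Rightarrow> nat set" where
  "feasible_bins L f x = {b \<in> bins_used L f. valid_bin (bin L f b @ [x])}"

text \<open>The packings Worst Fit may produce on \<open>L\<close>. Ties between bins of lowest level may be broken
  arbitrarily, so there can be several.\<close>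

definition worst_fit :: "item list \<Rightarrow> (nat \<Rightarrow> nat) \<Rightarrow> bool" where
  "worst_fit L f \<longleftrightarrow>
    (\<forall>i < length L.
      let P = take i L; F = feasible_bins P f (L ! i) in
        if F = {} then f i \<notin> bins_used P f
        else is_arg_min (\<lambda>b. level (bin P f b)) (\<lambda>b. b \<in> F) (f i))"

lemma OPT_attained:
  assumes "\<forall>x \<in> set L. item_size x \<le> 1"
  shows "\<exists>f. valid_packing L f \<and> card (bins_used L f) = OPT L"
proof -
  have "valid_bin (bin L id b)" if "b < length L" for b
  proof -
    have "nths L {b} = [L ! b]"
      using that
    proof (induction L arbitrary: b)
      case (Cons a L)
      then show ?case
        by (cases b) (auto simp: nths_Cons)
    qed simp
    then show ?thesis
      using that assms by (simp add: bin_def valid_bin_def level_def)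
  qed
  then have "valid_packing L id"
    by (auto simp: valid_packing_def bins_used_def)
  then have "\<exists>n f. valid_packing L f \<and> card (bins_used L f) = n"
    by blast
  then show ?thesis
    unfolding OPT_def by (rule LeastI_ex)
qed

lemma bins_cong:
  assumes "\<And>i. i < length L \<Longrightarrow> f i = g i"
  shows "bins_used L f = bins_used L g" and "bin L f b = bin L g b"
proof -
  show "bins_used L f = bins_used L g"
    using assms by (auto simp: bins_used_def)
  show "bin L f b = bin L g b"
    using assms unfolding bin_def nths_def
    by (intro arg_cong[where f = "map fst"] filter_cong) (auto simp: set_zip)
qed

lemma feasible_bins_cong:
  assumes "\<And>i. i < length L \<Longrightarrow> f i = g i"
  shows "feasible_bins L f x = feasible_bins L g x"
  using bins_cong[OF assms] by (simp add: feasible_bins_def)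

lemma worst_fit_exists: "\<exists>f. worst_fit L f"
proof (induction L rule: rev_induct)
  case Nil
  show ?case by (simp add: worst_fit_def)
next
  case (snoc x L)
  then obtain f where f: "worst_fit L f" by blast
  define F where "F = feasible_bins L f x"
  have fin: "finite (bins_used L f)" "finite F"
    by (auto simp: bins_used_def F_def feasible_bins_def)
  have "\<exists>b. if F = {} then b \<notin> bins_used L f
            else is_arg_min (\<lambda>b. level (bin L f b)) (\<lambda>b. b \<in> F) b"
    using ex_is_arg_min_if_finite[OF fin(2)] ex_new_if_finite[OF infinite_UNIV_nat fin(1)]
    by auto
  then obtain b where b: "if F = {} then b \<notin> bins_used L f
            else is_arg_min (\<lambda>b. level (bin L f b)) (\<lambda>b. b \<in> F) b" ..
  define g where "g = f(length L := b)"
  have cong: "bins_used (take i L) g = bins_used (take i L) f"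
    "bin (take i L) g c = bin (take i L) f c"
    "feasible_bins (take i L) g y = feasible_bins (take i L) f y" for i c y
    by (rule bins_cong feasible_bins_cong; simp add: g_def)+
  have "worst_fit (L @ [x]) g"
    unfolding worst_fit_def
  proof (intro allI impI)
    fix i assume "i < length (L @ [x])"
    then consider "i < length L" | "i = length L" by fastforce
    then show "let P = take i (L @ [x]); F = feasible_bins P g ((L @ [x]) ! i) in
        if F = {} then g i \<notin> bins_used P g
        else is_arg_min (\<lambda>b. level (bin P g b)) (\<lambda>b. b \<in> F) (g i)"
    proof cases
      case 1
      then have "g i = f i" by (simp add: g_def)
      with 1 f show ?thesis
        by (simp add: worst_fit_def nth_append cong Let_def)
    next
      case 2
      then show ?thesis
        using b cong[of "length L"] by (simp add: g_def F_def Let_def split: if_splits)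
    qed
  qed
  then show ?case by blast
qed

end

theory Submission
  imports Defs
begin

text \<open>
  Call a bin small if its level is at most \<open>1 - 1/d\<close>, so that any item of the opposite colour
  still fits. Each big bin has level above \<open>1 - 1/d\<close>, so the total size bounds the number of big
  bins by \<open>d/(d-1) \<cdot> OPT\<close>. For a colour \<open>c\<close>, an item of the other colour is always put by Worst
  Fit on a small bin with top \<open>c\<close> as long as there is one. Hence the number of those bins is
  dominated by a walk with steps \<open>\<plusminus>1\<close> reflected at zero, i.e. by the excess of \<open>c\<close>-items over the
  other ones in some suffix of the input. Adding the two bounds for black and white, the common part
  of the two suffixes cancels, and what remains is the excess of one colour in a contiguous
  segment, which is a lower bound for the number of bins of every valid packing.
\<close>

section \<open>Colour excess of item sequences\<close>

definition excess :: "color \<Rightarrow> item list \<Rightarrow> int" where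
  "excess c xs = sum_list (map (\<lambda>x. if item_color x = c then 1 else - 1) xs)"

lemma excess_Nil [simp]: "excess c [] = 0"
  by (simp add: excess_def)

lemma excess_Cons [simp]:
  "excess c (x # xs) = (if item_color x = c then 1 else - 1) + excess c xs"
  by (simp add: excess_def)

lemma excess_append [simp]: "excess c (xs @ ys) = excess c xs + excess c ys"
  by (simp add: excess_def)

lemma color_eq_iff: "a \<noteq> c \<Longrightarrow> b \<noteq> c \<Longrightarrow> a = (b :: color)"
  by (cases a; cases b; cases c) auto

lemma excess_opposite: "c \<noteq> c' \<Longrightarrow> excess c xs + excess c' xs = 0"
proof (induction xs)
  case (Cons x xs)
  then show ?case
    using color_eq_iff[of c "item_color x" c'] by auto
qed simp

text \<open>Later only the bound 1 matters. The case split on the head carries the induction: a new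
  head of colour \<open>c\<close> meets a tail with a head of the other colour, or an empty one,
  hence of excess at most 0.\<close>

lemma excess_alternating_le:
  assumes "successively (\<lambda>x y. item_color x \<noteq> item_color y) xs"
  shows "excess c xs \<le> (if xs \<noteq> [] \<and> item_color (hd xs) = c then 1 else 0)"
  using assms
proof (induction xs)
  case (Cons x xs)
  then show ?case
    by (cases xs) (auto split: if_splits)
qed simp

lemma nths_snoc: "nths (xs @ [x]) A = nths xs A @ (if length xs \<in> A then [x] else [])"
  by (simp add: nths_append)

text \<open>Each position lies in exactly one fibre of \<open>k\<close>. \<open>B\<close> may exceed
  the image of \<open>k\<close>, so that a segment can be summed over all bins of the whole
  list.\<close>

lemma sum_list_nths_fibres:
  fixes h :: "'a \<Rightarrow> 'b::comm_monoid_add"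
  assumes "finite B" and "k ` {..<length xs} \<subseteq> B"
  shows "(\<Sum>b\<in>B. sum_list (map h (nths xs {i. k i = b}))) = sum_list (map h xs)"
  using assms(2)
proof (induction xs rule: rev_induct)
  case (snoc x xs)
  have "(\<Sum>b\<in>B. sum_list (map h (nths (xs @ [x]) {i. k i = b})))
      = (\<Sum>b\<in>B. sum_list (map h (nths xs {i. k i = b})) + (if k (length xs) = b then h x else 0))"
    by (intro sum.cong) (auto simp: nths_snoc)
  also have "\<dots> = sum_list (map h xs) + h x"
    using snoc assms(1) by (auto simp: sum.distrib image_subset_iff)
  finally show ?case by simp
qed simp

section \<open>Bins of a packing and lower bounds for valid packings\<close>

lemma finite_bins_used [simp]: "finite (bins_used L f)"
  by (simp add: bins_used_def)

lemma bins_used_snoc: "bins_used (L @ [x]) f = insert (f (length L)) (bins_used L f)"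
  by (auto simp: bins_used_def lessThan_Suc)

lemma bin_snoc: "bin (L @ [x]) f b = bin L f b @ (if f (length L) = b then [x] else [])"
  by (simp add: bin_def nths_snoc)

lemma bin_eq_Nil_iff: "bin L f b = [] \<longleftrightarrow> b \<notin> bins_used L f"
proof (induction L rule: rev_induct)
  case Nil
  show ?case by (simp add: bin_def bins_used_def)
qed (auto simp: bin_snoc bins_used_snoc)

lemma level_Nil [simp]: "level [] = 0"
  by (simp add: level_def)

lemma level_append [simp]: "level (xs @ ys) = level xs + level ys"
  by (simp add: level_def)

lemma sum_level_bins: "(\<Sum>b\<in>bins_used L f. level (bin L f b)) = level L"
  unfolding level_def bin_def by (rule sum_list_nths_fibres) (auto simp: bins_used_def)

lemma level_le_card_bins_used:
  assumes "valid_packing L g"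
  shows "level L \<le> real (card (bins_used L g))"
proof -
  have "(\<Sum>b\<in>bins_used L g. level (bin L g b)) \<le> (\<Sum>b\<in>bins_used L g. 1)"
    using assms by (intro sum_mono) (auto simp: valid_packing_def valid_bin_def)
  then show ?thesis by (simp add: sum_level_bins)
qed

text \<open>Within each bin the items of \<open>vs\<close> are consecutive, so they still alternate
  and have excess at most 1.\<close>

lemma excess_segment_le_card_bins_used:
  assumes "valid_packing (us @ vs @ ws) g"
  shows "excess c vs \<le> int (card (bins_used (us @ vs @ ws) g))"
proof -
  let ?B = "bins_used (us @ vs @ ws) g"
  have le: "excess c (nths vs {i. g (i + length us) = b}) \<le> 1" if "b \<in> ?B" for b
  proof -
    have "successively (\<lambda>x y. item_color x \<noteq> item_color y)
        (nths vs {i. g (i + length us) = b})"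
      using assms that
      by (auto simp: valid_packing_def valid_bin_def bin_def nths_append successively_append_iff)
    from excess_alternating_le[OF this, of c] show ?thesis by (simp split: if_splits)
  qed
  have "excess c vs = (\<Sum>b\<in>?B. excess c (nths vs {i. g (i + length us) = b}))"
    unfolding excess_def by (rule sum_list_nths_fibres[symmetric]) (auto simp: bins_used_def)
  also have "\<dots> \<le> (\<Sum>b\<in>?B. 1)"
    using le by (intro sum_mono) auto
  finally show ?thesis by simp
qed

section \<open>Worst Fit and its small bins\<close>

lemma worst_fit_snocD:
  assumes "worst_fit (L @ [x]) f"
  shows "worst_fit L f"
    and "if feasible_bins L f x = {} then f (length L) \<notin> bins_used L f
      else is_arg_min (\<lambda>b. level (bin L f b)) (\<lambda>b. b \<in> feasible_bins L f x) (f (length L))"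
proof -
  show "worst_fit L f"
    unfolding worst_fit_def
  proof (intro allI impI)
    fix i assume "i < length L"
    then show "let P = take i L; F = feasible_bins P f (L ! i) in
        if F = {} then f i \<notin> bins_used P f
        else is_arg_min (\<lambda>b. level (bin P f b)) (\<lambda>b. b \<in> F) (f i)"
      using assms[unfolded worst_fit_def, rule_format, of i] by (simp add: nth_append)
  qed
  show "if feasible_bins L f x = {} then f (length L) \<notin> bins_used L f
      else is_arg_min (\<lambda>b. level (bin L f b)) (\<lambda>b. b \<in> feasible_bins L f x) (f (length L))"
    using assms[unfolded worst_fit_def, rule_format, of "length L"] by (simp add: Let_def)
qed

lemma worst_fit_valid_packing:
  assumes "worst_fit L f" and "\<forall>x \<in> set L. item_size x \<le> 1"
  shows "valid_packing L f"
  using assms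
proof (induction L rule: rev_induct)
  case Nil
  show ?case by (simp add: valid_packing_def bins_used_def)
next
  case (snoc x L)
  have IH: "valid_packing L f"
    using snoc worst_fit_snocD(1) by auto
  have "valid_bin (bin L f (f (length L)) @ [x])"
  proof (cases "feasible_bins L f x = {}")
    case True
    then have "bin L f (f (length L)) = []"
      using worst_fit_snocD(2)[OF snoc.prems(1)] by (simp add: bin_eq_Nil_iff)
    then show ?thesis
      using snoc.prems(2) by (simp add: valid_bin_def level_def)
  next
    case False
    then have "f (length L) \<in> feasible_bins L f x"
      using worst_fit_snocD(2)[OF snoc.prems(1)] by (simp add: is_arg_min_def)
    then show ?thesis
      by (simp add: feasible_bins_def)
  qed
  then show ?case
    using IH by (auto simp: valid_packing_def bins_used_snoc bin_snoc)
qed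

text \<open>Here \<open>t\<close> stands for a bound on all item sizes. Used bins are nonempty, so
  \<open>last\<close> is the top item, the one that decides which colour may follow.\<close>

definition small_bins :: "real \<Rightarrow> color \<Rightarrow> item list \<Rightarrow> (nat \<Rightarrow> nat) \<Rightarrow> nat set" where
  "small_bins t c L f =
    {b \<in> bins_used L f. level (bin L f b) \<le> 1 - t \<and> item_color (last (bin L f b)) = c}"

lemma finite_small_bins [simp]: "finite (small_bins t c L f)"
  by (simp add: small_bins_def)

text \<open>A small bin with top \<open>c\<close> is feasible for \<open>x\<close>, so the chosen
  bin of lowest level is small too. As there are only two colours, feasibility forces its top to be
  \<open>c\<close>.\<close>

lemma worst_fit_uses_small_bin:
  assumes "worst_fit (L @ [x]) f" and "valid_packing L f" and "item_size x \<le> t"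
    and "item_color x \<noteq> c" and "small_bins t c L f \<noteq> {}"
  shows "f (length L) \<in> small_bins t c L f"
proof -
  let ?b = "f (length L)"
  obtain b where b: "b \<in> bins_used L f" "level (bin L f b) \<le> 1 - t"
    "item_color (last (bin L f b)) = c"
    using assms(5) by (auto simp: small_bins_def)
  then have "b \<in> feasible_bins L f x"
    using assms(2-4)
    by (auto simp: feasible_bins_def valid_bin_def valid_packing_def successively_append_iff
        level_def bin_eq_Nil_iff)
  then have "?b \<in> feasible_bins L f x" "level (bin L f ?b) \<le> level (bin L f b)"
    using worst_fit_snocD(2)[OF assms(1)] by (auto simp: is_arg_min_linorder split: if_splits)
  moreover from this(1) have "item_color (last (bin L f ?b)) \<noteq> item_color x"
    by (auto simp: feasible_bins_def valid_bin_def successively_append_iff bin_eq_Nil_iff)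
  ultimately show ?thesis
    using b(2) color_eq_iff[OF _ assms(4)[symmetric]] by (simp add: small_bins_def feasible_bins_def)
qed

text \<open>Only the bin receiving \<open>x\<close> changes, and \<open>x\<close> becomes its top.
  Equality may fail, because that bin may stop being small.\<close>

lemma small_bins_snoc_subset:
  "small_bins t c (L @ [x]) f \<subseteq>
    (if item_color x = c then insert (f (length L)) (small_bins t c L f)
     else small_bins t c L f - {f (length L)})"
  by (auto simp: small_bins_def bins_used_snoc bin_snoc split: if_splits)

lemma card_small_bins_le_excess_suffix:
  assumes "worst_fit L f" and "\<forall>x \<in> set L. item_size x \<le> 1 \<and> item_size x \<le> t"
  shows "\<exists>ys zs. L = ys @ zs \<and> int (card (small_bins t c L f)) \<le> excess c zs"
  using assms
proof (induction L rule: rev_induct)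
  case Nil
  show ?case by (simp add: small_bins_def bins_used_def)
next
  case (snoc x L)
  let ?S = "small_bins t c L f" and ?S' = "small_bins t c (L @ [x]) f" and ?b = "f (length L)"
  have wf: "worst_fit L f"
    using snoc.prems(1) by (rule worst_fit_snocD)
  obtain ys zs where zs: "L = ys @ zs" "int (card ?S) \<le> excess c zs"
    using snoc.IH[OF wf] snoc.prems(2) by auto
  have sub: "?S' \<subseteq> (if item_color x = c then insert ?b ?S else ?S - {?b})"
    by (rule small_bins_snoc_subset)
  show ?case
  proof (cases "item_color x \<noteq> c \<and> ?S = {}")
    \<comment> \<open>Reflection at zero: the suffix restarts as empty, just after
      \<open>x\<close>.\<close>
    case True
    then have "?S' = {}"
      using sub by auto
    then have "L @ [x] = (L @ [x]) @ [] \<and> int (card ?S') \<le> excess c []"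
      by simp
    then show ?thesis by blast
  next
    case False
    have "int (card ?S') \<le> excess c (zs @ [x])"
    proof (cases "item_color x = c")
      case True
      then have "card ?S' \<le> card (insert ?b ?S)"
        using sub by (intro card_mono) auto
      also have "\<dots> \<le> Suc (card ?S)"
        by (simp add: card_insert_if)
      finally show ?thesis
        using zs(2) True by simp
    next
      case neq: False
      have "valid_packing L f"
        using wf snoc.prems(2) by (intro worst_fit_valid_packing) auto
      \<comment> \<open>A small bin with top \<open>c\<close> exists, so \<open>x\<close> is put on
        one and removes it from the set; this pays for the step -1 of the excess.\<close>
      then have mem: "?b \<in> ?S"
        using neq False snoc.prems by (intro worst_fit_uses_small_bin) auto
      have "card ?S' \<le> card (?S - {?b})"
        using sub neq by (intro card_mono) auto
      moreover have "card ?S = Suc (card (?S - {?b}))"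
        using mem by (intro card.remove) auto
      ultimately show ?thesis
        using zs(2) neq by simp
    qed
    then show ?thesis
      using zs(1) by (metis append.assoc)
  qed
qed

lemma excess_suffixes_le_card_bins_used:
  assumes "valid_packing L g" and "L = ys @ zs" and "L = ys' @ zs'" and "c \<noteq> c'"
  shows "excess c zs + excess c' zs' \<le> int (card (bins_used L g))"
proof -
  \<comment> \<open>One suffix contains the other. On the shorter one the two excesses cancel, and
    \<open>us\<close> is the segment that remains.\<close>
  obtain us where "ys = ys' @ us \<and> us @ zs = zs' \<or> ys @ us = ys' \<and> zs = us @ zs'"
    using assms(2,3) append_eq_append_conv2[of ys zs ys' zs'] by auto
  then show ?thesis
  proof
    assume us: "ys = ys' @ us \<and> us @ zs = zs'"
    then have "excess c zs + excess c' zs' = excess c' us"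
      using excess_opposite[OF assms(4), of zs] by auto
    then show ?thesis
      using excess_segment_le_card_bins_used[of ys' us zs g c'] assms(1,2) us by simp
  next
    assume us: "ys @ us = ys' \<and> zs = us @ zs'"
    then have "excess c zs + excess c' zs' = excess c us"
      using excess_opposite[OF assms(4), of zs'] by auto
    then show ?thesis
      using excess_segment_le_card_bins_used[of ys us zs' g c] assms(1,2) us by simp
  qed
qed

lemma card_high_level_bins_le:
  assumes "\<forall>x \<in> set L. 0 \<le> item_size x"
  shows "real (card {b \<in> bins_used L f. level (bin L f b) > s}) * s \<le> level L"
proof -
  let ?H = "{b \<in> bins_used L f. level (bin L f b) > s}"
  have "(\<Sum>b\<in>?H. s) \<le> (\<Sum>b\<in>?H. level (bin L f b))"
    by (intro sum_mono) auto
  also have "\<dots> \<le> (\<Sum>b\<in>bins_used L f. level (bin L f b))"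
    using assms
    by (intro sum_mono2) (auto simp: level_def bin_def set_nths intro!: sum_list_nonneg)
  finally show ?thesis by (simp add: sum_level_bins)
qed

theorem theorem5p3:
  fixes d :: real and L :: "item list" and f :: "nat \<Rightarrow> nat"
  assumes "d \<ge> 2"
    and "\<forall>x \<in> set L. 0 \<le> item_size x \<and> item_size x \<le> 1"
    and "\<forall>x \<in> set L. item_size x \<le> 1 / d"
    and "worst_fit L f"
  shows "real (card (bins_used L f)) \<le> (1 + d / (d - 1)) * real (OPT L)"
proof -
  let ?S = "\<lambda>c. small_bins (1 / d) c L f"
  let ?H = "{b \<in> bins_used L f. level (bin L f b) > 1 - 1 / d}"
  obtain g where g: "valid_packing L g" "card (bins_used L g) = OPT L"
    using OPT_attained assms(2) by blast
  have sizes: "\<forall>x \<in> set L. item_size x \<le> 1 \<and> item_size x \<le> 1 / d"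
    using assms(2,3) by auto
  obtain ys zs where zs: "L = ys @ zs" "int (card (?S Black)) \<le> excess Black zs"
    using card_small_bins_le_excess_suffix[OF assms(4) sizes] by blast
  obtain ys' zs' where zs': "L = ys' @ zs'" "int (card (?S White)) \<le> excess White zs'"
    using card_small_bins_le_excess_suffix[OF assms(4) sizes] by blast
  have small: "card (?S Black) + card (?S White) \<le> OPT L"
    using excess_suffixes_le_card_bins_used[OF g(1) zs(1) zs'(1), of Black White] zs(2) zs'(2) g(2)
    by simp
  \<comment> \<open>The packing \<open>g\<close> fits the total size into \<open>OPT L\<close> bins
    of capacity 1.\<close>
  have "real (card ?H) * (1 - 1 / d) \<le> real (OPT L)"
    using card_high_level_bins_le[of L f "1 - 1 / d"] level_le_card_bins_used[OF g(1)] g(2) assms(2)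
    by simp
  then have high: "real (card ?H) \<le> d / (d - 1) * real (OPT L)"
    using assms(1) by (simp add: field_simps)
  \<comment> \<open>A used bin that is not high is small, with a black or a white top.\<close>
  have "bins_used L f = (?S Black \<union> ?S White) \<union> ?H"
    by (auto simp: small_bins_def) (metis color.exhaust)
  then have "card (bins_used L f) \<le> card (?S Black \<union> ?S White) + card ?H"
    by (metis card_Un_le)
  also have "\<dots> \<le> card (?S Black) + card (?S White) + card ?H"
    by (simp add: card_Un_le)
  finally have "real (card (bins_used L f)) \<le> real (OPT L) + real (card ?H)"
    using small by linarith
  then show ?thesis
    using high by (simp add: algebra_simps)
qed

end
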